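(* Let $N\in\mathbb{N}$, let $F_N=\langle g_1,\dots,g_N\rangle$ be the free group on $N$ generators, let $\tau$ be the canonical trace on the free group von Neumann algebra $L(F_N)$, and let $G=g_1+\dots+g_N+g_1^{-1}+\dots+g_N^{-1}\in L(F_N)$ be the generating operator. With the integers $p^{n}_0$ ($n$ even) defined recursively in the context, for all $n\in\mathbb{N}$, $$\tau(G^n)=\begin{cases}0 & \text{if } n \text{ is odd},\\ p^n_0 & \text{if } n\text{ is even}.\end{cases}$$
   Context: $L(F_N)$ is the weak closure of the group algebra $\mathbb{C}[F_N]$, with group elements identified with the corresponding unitaries, and $\tau\left(\sum_{g\in F_N}t_g g\right)=t_e$, where $e$ is the identity of $F_N$. $\mathbb{N}=\{1,2,3,\dots\}$. The integers $p^{2m}_{2i}$ ($m\ge 1$, $0\le i\le m-1$) and $q^{2m+1}_{2i+1}$ ($m\ge1$, $0\le i\le m-1$), depending on $N$, are defined recursively by $p^2_0=2N$, $q^3_1=(2N-1)+2N$, and for every $m\ge 2$: - $p^{2m}_{2m-2}=(2N-1)+q^{2m-1}_{2m-3}$; - $p^{2m}_{2i}=(2N-1)q^{2m-1}_{2i+1}+q^{2m-1}_{2i-1}$ for $1\le i\le m-2$; - $p^{2m}_0=(2N)q^{2m-1}_1$; - $q^{2m+1}_{2m-1}=(2N-1)+p^{2m}_{2m-2}$; - $q^{2m+1}_{2i+1}=(2N-1)p^{2m}_{2i+2}+p^{2m}_{2i}$ for $0\le i\le m-2$. *)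

theory Defs
  imports "HOL-Analysis.Analysis" "HOL-Algebra.Generated_Groups" "HOL-Algebra.Ring"
begin

text \<open>The letter \<open>(i, True)\<close> stands for the generator $g_i$ and \<open>(i, False)\<close> for its inverse;
  the elements of the free group are the reduced words.\<close>

type_synonym letter = "nat \<times> bool"

definition inv_letter :: "letter \<Rightarrow> letter" where
  "inv_letter a = (fst a, \<not> snd a)"

fun reduced :: "letter list \<Rightarrow> bool" where
  "reduced (a # b # w) \<longleftrightarrow> b \<noteq> inv_letter a \<and> reduced (b # w)"
| "reduced _ \<longleftrightarrow> True"

text \<open>Left multiplication of a reduced word by one letter.\<close>

fun push :: "letter \<Rightarrow> letter list \<Rightarrow> letter list" where
  "push a [] = [a]"
| "push a (b # w) = (if b = inv_letter a then w else a # b # w)"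

definition free_group :: "nat \<Rightarrow> letter list monoid" where
  "free_group N = \<lparr>carrier = {w. reduced w \<and> set w \<subseteq> {1..N} \<times> UNIV},
                   monoid.mult = (\<lambda>u v. foldr push u v),
                   one = []\<rparr>"

definition gen :: "nat \<Rightarrow> letter list" where
  "gen i = [(i, True)]"

lemma inv_letter_invol [simp]: "inv_letter (inv_letter a) = a"
  by (simp add: inv_letter_def)

lemma inv_letter_neq [simp]: "inv_letter a \<noteq> a" "a \<noteq> inv_letter a"
  by (simp_all add: inv_letter_def prod_eq_iff)

lemma inv_letter_in [simp]: "inv_letter a \<in> A \<times> UNIV \<longleftrightarrow> a \<in> A \<times> UNIV"
  by (auto simp: inv_letter_def mem_Times_iff)

lemma reduced_ConsD: "reduced (a # w) \<Longrightarrow> reduced w"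
  by (cases w) auto

lemma reduced_push: "reduced w \<Longrightarrow> reduced (push a w)"
  by (cases w) (auto dest: reduced_ConsD)

lemma reduced_foldr_push: "reduced w \<Longrightarrow> reduced (foldr push u w)"
  by (induction u) (auto intro: reduced_push)

lemma set_push: "set (push a w) \<subseteq> insert a (set w)"
  by (cases w) auto

lemma set_foldr_push: "set (foldr push u w) \<subseteq> set u \<union> set w"
  by (induction u) (use set_push in fastforce)+

lemma push_inv_push: "reduced w \<Longrightarrow> push (inv_letter a) (push a w) = w"
proof (cases w)
  case (Cons b v)
  assume r: "reduced w"
  show ?thesis
  proof (cases "b = inv_letter a")
    case True
    then show ?thesis using r Cons by (cases v) auto
  qed (use Cons in auto)
qed auto

lemma push_push_inv: "reduced w \<Longrightarrow> push a (push (inv_letter a) w) = w"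
  using push_inv_push[of w "inv_letter a"] by simp

lemma foldr_push_push:
  assumes "reduced u" "reduced w"
  shows "foldr push (push a u) w = push a (foldr push u w)"
proof (cases u)
  case (Cons b v)
  then show ?thesis
    using push_push_inv[of "foldr push v w" a] reduced_foldr_push[OF assms(2)] by auto
qed auto

lemma foldr_push_assoc:
  assumes "reduced v" "reduced w"
  shows "foldr push (foldr push u v) w = foldr push u (foldr push v w)"
  by (induction u) (simp_all add: foldr_push_push reduced_foldr_push assms)

lemma foldr_push_Nil: "reduced w \<Longrightarrow> foldr push w [] = w"
proof (induction w)
  case (Cons a w)
  then have "foldr push w [] = w" using reduced_ConsD by blast
  then show ?case using Cons.prems by (cases w) auto
qed auto

lemma ex_left_inverse:
  assumes "reduced w" "set w \<subseteq> A \<times> UNIV"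
  shows "\<exists>v. reduced v \<and> set v \<subseteq> A \<times> UNIV \<and> foldr push v w = []"
  using assms
proof (induction w)
  case (Cons a w)
  then obtain v where v: "reduced v" "set v \<subseteq> A \<times> UNIV" "foldr push v w = []"
    using reduced_ConsD by force
  define v' where "v' = foldr push v [inv_letter a]"
  have "set v' \<subseteq> A \<times> UNIV"
  proof -
    have "inv_letter a \<in> A \<times> UNIV" using Cons.prems unfolding inv_letter_in by simp
    then have "set v \<union> set [inv_letter a] \<subseteq> A \<times> UNIV" using v(2) by simp
    then show ?thesis using set_foldr_push[of v "[inv_letter a]"] unfolding v'_def by (rule order_trans[rotated])
  qed
  moreover have "foldr push v' (a # w) = []"
    using v Cons.prems by (simp add: v'_def foldr_push_assoc)
  moreover have "reduced v'" by (simp add: v'_def reduced_foldr_push)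
  ultimately show ?case by blast
qed (auto intro: exI[of _ "[]"])

lemma group_free_group: "group (free_group N)"
proof (rule groupI)
  fix x y assume "x \<in> carrier (free_group N)" "y \<in> carrier (free_group N)"
  then show "x \<otimes>\<^bsub>free_group N\<^esub> y \<in> carrier (free_group N)"
    using set_foldr_push[of x y] by (auto simp: free_group_def reduced_foldr_push)
next
  fix x assume "x \<in> carrier (free_group N)"
  then show "\<exists>y\<in>carrier (free_group N). y \<otimes>\<^bsub>free_group N\<^esub> x = \<one>\<^bsub>free_group N\<^esub>"
    using ex_left_inverse[of x "{1..N}"] by (auto simp: free_group_def)
qed (auto simp: free_group_def foldr_push_assoc)

lemma gen_in_carrier: "i \<in> {1..N} \<Longrightarrow> gen i \<in> carrier (free_group N)"
  by (simp add: gen_def free_group_def)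

lemma inv_gen: "i \<in> {1..N} \<Longrightarrow> inv\<^bsub>free_group N\<^esub> (gen i) = [(i, False)]"
  by (rule group.inv_equality[OF group_free_group])
    (simp_all add: gen_def free_group_def inv_letter_def)

lemma generate_gens: "generate (free_group N) (gen ` {1..N}) = carrier (free_group N)"
proof
  show "generate (free_group N) (gen ` {1..N}) \<subseteq> carrier (free_group N)"
    using gen_in_carrier by (intro group.generate_incl[OF group_free_group]) auto
  show "carrier (free_group N) \<subseteq> generate (free_group N) (gen ` {1..N})"
  proof
    fix w assume "w \<in> carrier (free_group N)"
    then have "reduced w" "set w \<subseteq> {1..N} \<times> UNIV" by (simp_all add: free_group_def)
    then show "w \<in> generate (free_group N) (gen ` {1..N})"
    proof (induction w)
      case Nil
      show ?case using generate.one[of "free_group N"] by (simp add: free_group_def)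
    next
      case (Cons a w)
      obtain i b where a: "a = (i, b)" "i \<in> {1..N}" using Cons.prems by (cases a) auto
      have "[a] \<in> generate (free_group N) (gen ` {1..N})"
        using generate.incl[of "gen i" "gen ` {1..N}" "free_group N"]
          generate.inv[of "gen i" "gen ` {1..N}" "free_group N"] a inv_gen[OF a(2)]
        by (cases b) (auto simp: gen_def)
      moreover have "w \<in> generate (free_group N) (gen ` {1..N})"
        using Cons reduced_ConsD by simp
      moreover have "[a] \<otimes>\<^bsub>free_group N\<^esub> w = a # w"
        using Cons.prems(1) by (cases w) (auto simp: free_group_def)
      ultimately show ?case using generate.eng by fastforce
    qed
  qed
qed

text \<open>Functions are set to 0 outside of \<open>S\<close>.\<close>

definition l2 :: "'a set \<Rightarrow> ('a \<Rightarrow> complex) set" where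
  "l2 S = {f. (\<forall>x. x \<notin> S \<longrightarrow> f x = 0) \<and> (\<lambda>x. (cmod (f x))\<^sup>2) summable_on S}"

definition l2_inner :: "'a set \<Rightarrow> ('a \<Rightarrow> complex) \<Rightarrow> ('a \<Rightarrow> complex) \<Rightarrow> complex" where
  "l2_inner S f h = (\<Sum>\<^sub>\<infinity>x\<in>S. f x * cnj (h x))"

definition l2_norm :: "'a set \<Rightarrow> ('a \<Rightarrow> complex) \<Rightarrow> real" where
  "l2_norm S f = sqrt (\<Sum>\<^sub>\<infinity>x\<in>S. (cmod (f x))\<^sup>2)"

definition delta :: "'a \<Rightarrow> 'a \<Rightarrow> complex" where
  "delta g = (\<lambda>x. if x = g then 1 else 0)"

text \<open>Operators are extensional functions on \<open>l2 S\<close>, so that equal operators are equal as terms.\<close>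

definition bounded_ops :: "'a set \<Rightarrow> (('a \<Rightarrow> complex) \<Rightarrow> ('a \<Rightarrow> complex)) set" where
  "bounded_ops S = {T \<in> l2 S \<rightarrow>\<^sub>E l2 S.
     (\<forall>f\<in>l2 S. \<forall>h\<in>l2 S. \<forall>a b. T (\<lambda>x. a * f x + b * h x) = (\<lambda>x. a * T f x + b * T h x)) \<and>
     (\<exists>C. \<forall>f\<in>l2 S. l2_norm S (T f) \<le> C * l2_norm S f)}"

text \<open>The coarsest topology making all matrix coefficients of operators continuous.\<close>

definition weak_operator_topology ::
    "'a set \<Rightarrow> (('a \<Rightarrow> complex) \<Rightarrow> ('a \<Rightarrow> complex)) topology" where
  "weak_operator_topology S =
     pullback_topology (bounded_ops S)
       (\<lambda>T. \<lambda>(f, h)\<in>l2 S \<times> l2 S. l2_inner S (T f) h)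
       (product_topology (\<lambda>_. euclidean) (l2 S \<times> l2 S))"

text \<open>The unitary with which a group element is identified, given by
  $(u_g f)(x) = f(g^{-1} x)$.\<close>

definition left_reg :: "('a, 'b) monoid_scheme \<Rightarrow> 'a \<Rightarrow> ('a \<Rightarrow> complex) \<Rightarrow> ('a \<Rightarrow> complex)" where
  "left_reg \<Gamma> g = (\<lambda>f\<in>l2 (carrier \<Gamma>). \<lambda>x. if x \<in> carrier \<Gamma> then f (inv\<^bsub>\<Gamma>\<^esub> g \<otimes>\<^bsub>\<Gamma>\<^esub> x) else 0)"

definition group_alg_elem ::
    "('a, 'b) monoid_scheme \<Rightarrow> 'a set \<Rightarrow> ('a \<Rightarrow> complex) \<Rightarrow> ('a \<Rightarrow> complex) \<Rightarrow> ('a \<Rightarrow> complex)" where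
  "group_alg_elem \<Gamma> K t = (\<lambda>f\<in>l2 (carrier \<Gamma>). \<lambda>x. \<Sum>g\<in>K. t g * left_reg \<Gamma> g f x)"

definition group_algebra ::
    "('a, 'b) monoid_scheme \<Rightarrow> (('a \<Rightarrow> complex) \<Rightarrow> ('a \<Rightarrow> complex)) set" where
  "group_algebra \<Gamma> = {group_alg_elem \<Gamma> K t | K t. finite K \<and> K \<subseteq> carrier \<Gamma>}"

definition group_vna ::
    "('a, 'b) monoid_scheme \<Rightarrow> (('a \<Rightarrow> complex) \<Rightarrow> ('a \<Rightarrow> complex)) ring" where
  "group_vna \<Gamma> =
     \<lparr>carrier = weak_operator_topology (carrier \<Gamma>) closure_of group_algebra \<Gamma>,
      monoid.mult = (\<lambda>S T. compose (l2 (carrier \<Gamma>)) S T),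
      one = (\<lambda>f\<in>l2 (carrier \<Gamma>). f),
      zero = (\<lambda>f\<in>l2 (carrier \<Gamma>). \<lambda>x. 0),
      add = (\<lambda>S T. \<lambda>f\<in>l2 (carrier \<Gamma>). \<lambda>x. S f x + T f x)\<rparr>"

text \<open>An element $T = \sum_g t_g g$ of the von Neumann algebra has the coefficients
  $t_g = \langle T \delta_e, \delta_g\rangle = (T \delta_e)(g)$.\<close>

definition vna_coeff ::
    "('a, 'b) monoid_scheme \<Rightarrow> (('a \<Rightarrow> complex) \<Rightarrow> ('a \<Rightarrow> complex)) \<Rightarrow> 'a \<Rightarrow> complex" where
  "vna_coeff \<Gamma> T g = T (delta \<one>\<^bsub>\<Gamma>\<^esub>) g"

definition vna_trace ::
    "('a, 'b) monoid_scheme \<Rightarrow> (('a \<Rightarrow> complex) \<Rightarrow> ('a \<Rightarrow> complex)) \<Rightarrow> complex" where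
  "vna_trace \<Gamma> T = vna_coeff \<Gamma> T \<one>\<^bsub>\<Gamma>\<^esub>"

lemma delta_in_l2: "g \<in> S \<Longrightarrow> delta g \<in> l2 S"
proof -
  assume g: "g \<in> S"
  have "(\<lambda>x. (cmod (delta g x))\<^sup>2) summable_on {g}" by simp
  then have "(\<lambda>x. (cmod (delta g x))\<^sup>2) summable_on S"
    by (rule summable_on_cong_neutral[THEN iffD1, rotated -1]) (use g in \<open>auto simp: delta_def\<close>)
  then show ?thesis using g by (auto simp: l2_def delta_def)
qed

lemma vna_coeff_group_alg_elem:
  assumes "group \<Gamma>" "finite K" "K \<subseteq> carrier \<Gamma>" "g \<in> carrier \<Gamma>"
  shows "vna_coeff \<Gamma> (group_alg_elem \<Gamma> K t) g = (if g \<in> K then t g else 0)"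
proof -
  interpret group \<Gamma> by fact
  have "left_reg \<Gamma> h (delta \<one>\<^bsub>\<Gamma>\<^esub>) g = (if h = g then 1 else 0)" if "h \<in> K" for h
  proof -
    have h: "h \<in> carrier \<Gamma>" using that assms(3) by auto
    have "inv\<^bsub>\<Gamma>\<^esub> h \<otimes>\<^bsub>\<Gamma>\<^esub> g = \<one>\<^bsub>\<Gamma>\<^esub> \<longleftrightarrow> h = g"
      using h assms(4) by (metis inv_closed inv_equality inv_inv l_inv)
    then show ?thesis using assms(4) delta_in_l2[OF one_closed] by (simp add: left_reg_def delta_def)
  qed
  then show ?thesis using assms(2)
    by (simp add: vna_coeff_def group_alg_elem_def delta_in_l2 if_distrib[of "\<lambda>z. _ * z"] cong: if_cong)
qed

lemma left_reg_l2:
  assumes "group \<Gamma>" "g \<in> carrier \<Gamma>" "f \<in> l2 (carrier \<Gamma>)"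
  shows "left_reg \<Gamma> g f \<in> l2 (carrier \<Gamma>)"
    and "l2_norm (carrier \<Gamma>) (left_reg \<Gamma> g f) = l2_norm (carrier \<Gamma>) f"
proof -
  interpret group \<Gamma> by fact
  let ?m = "\<lambda>x. inv\<^bsub>\<Gamma>\<^esub> g \<otimes>\<^bsub>\<Gamma>\<^esub> x"
  let ?F = "\<lambda>x. (cmod (f x))\<^sup>2"
  have bij: "bij_betw ?m (carrier \<Gamma>) (carrier \<Gamma>)"
    by (rule bij_betwI[where g = "\<lambda>x. g \<otimes>\<^bsub>\<Gamma>\<^esub> x"])
      (use assms(2) in \<open>auto simp: m_assoc[symmetric]\<close>)
  have eq: "left_reg \<Gamma> g f = (\<lambda>x. if x \<in> carrier \<Gamma> then f (?m x) else 0)"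
    using assms(3) by (simp add: left_reg_def)
  have "(\<lambda>x. ?F (?m x)) summable_on carrier \<Gamma>"
    using summable_on_reindex_bij_betw[OF bij, of ?F] assms(3) by (simp add: l2_def)
  then have "(\<lambda>x. (cmod (left_reg \<Gamma> g f x))\<^sup>2) summable_on carrier \<Gamma>"
    by (rule summable_on_cong[THEN iffD1, rotated]) (simp add: eq)
  then show "left_reg \<Gamma> g f \<in> l2 (carrier \<Gamma>)" by (auto simp: l2_def eq)
  have "(\<Sum>\<^sub>\<infinity>x\<in>carrier \<Gamma>. (cmod (left_reg \<Gamma> g f x))\<^sup>2) = (\<Sum>\<^sub>\<infinity>x\<in>carrier \<Gamma>. ?F (?m x))"
    by (rule infsum_cong) (simp add: eq)
  also have "\<dots> = (\<Sum>\<^sub>\<infinity>x\<in>carrier \<Gamma>. ?F x)"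
    by (rule infsum_reindex_bij_betw[OF bij])
  finally show "l2_norm (carrier \<Gamma>) (left_reg \<Gamma> g f) = l2_norm (carrier \<Gamma>) f"
    by (simp add: l2_norm_def)
qed

lemma has_sum_finite_sum:
  fixes F :: "'k \<Rightarrow> 'a \<Rightarrow> 'b::topological_comm_monoid_add"
  assumes "finite K" "\<And>k. k \<in> K \<Longrightarrow> (F k has_sum s k) S"
  shows "((\<lambda>x. \<Sum>k\<in>K. F k x) has_sum (\<Sum>k\<in>K. s k)) S"
  using assms by (induction K) (auto intro: has_sum_add)

lemma l2_lincomb:
  fixes t :: "'k \<Rightarrow> complex"
  assumes "finite K" "\<And>k. k \<in> K \<Longrightarrow> F k \<in> l2 S" "\<And>k. k \<in> K \<Longrightarrow> l2_norm S (F k) = r"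
  shows "(\<lambda>x. \<Sum>k\<in>K. t k * F k x) \<in> l2 S"
    and "l2_norm S (\<lambda>x. \<Sum>k\<in>K. t k * F k x) \<le> sqrt (card K * (\<Sum>k\<in>K. (cmod (t k))\<^sup>2)) * r"
proof -
  let ?B = "\<lambda>x. card K * (\<Sum>k\<in>K. (cmod (t k))\<^sup>2 * (cmod (F k x))\<^sup>2)"
  have bd: "(cmod (\<Sum>k\<in>K. t k * F k x))\<^sup>2 \<le> ?B x" for x
  proof -
    have "(cmod (\<Sum>k\<in>K. t k * F k x))\<^sup>2 \<le> (\<Sum>k\<in>K. cmod (t k * F k x))\<^sup>2"
      by (intro power_mono norm_sum) auto
    also have "\<dots> \<le> (\<Sum>k\<in>K. (cmod (t k * F k x))\<^sup>2) * card K"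
      by (rule sum_squared_le_sum_of_squares)
    finally show ?thesis by (simp add: norm_mult power_mult_distrib mult.commute)
  qed
  have sk: "(\<lambda>x. (cmod (F k x))\<^sup>2) summable_on S" if "k \<in> K" for k
    using assms(2)[OF that] by (simp add: l2_def)
  have hB: "((\<lambda>x. \<Sum>k\<in>K. (cmod (t k))\<^sup>2 * (cmod (F k x))\<^sup>2) has_sum
             (\<Sum>k\<in>K. (cmod (t k))\<^sup>2 * (\<Sum>\<^sub>\<infinity>x\<in>S. (cmod (F k x))\<^sup>2))) S"
    by (intro has_sum_finite_sum assms(1) has_sum_cmult_right has_sum_infsum sk)
  then have sB: "?B summable_on S"
    by (intro summable_on_cmult_right has_sum_imp_summable)
  have s: "(\<lambda>x. (cmod (\<Sum>k\<in>K. t k * F k x))\<^sup>2) summable_on S"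
    by (rule summable_on_comparison_test[OF sB]) (use bd in auto)
  then show "(\<lambda>x. \<Sum>k\<in>K. t k * F k x) \<in> l2 S"
    using assms(2) by (auto simp: l2_def)
  have r: "(\<Sum>\<^sub>\<infinity>x\<in>S. (cmod (F k x))\<^sup>2) = r\<^sup>2" if "k \<in> K" for k
    using assms(3)[OF that] infsum_nonneg[of S "\<lambda>x. (cmod (F k x))\<^sup>2"]
    by (auto simp: l2_norm_def)
  have "(\<Sum>\<^sub>\<infinity>x\<in>S. (cmod (\<Sum>k\<in>K. t k * F k x))\<^sup>2) \<le> (\<Sum>\<^sub>\<infinity>x\<in>S. ?B x)"
    by (rule infsum_mono[OF s sB]) (use bd in auto)
  also have "\<dots> = card K * (\<Sum>k\<in>K. (cmod (t k))\<^sup>2 * (\<Sum>\<^sub>\<infinity>x\<in>S. (cmod (F k x))\<^sup>2))"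
    using infsumI[OF hB] by (subst infsum_cmult_right') simp
  also have "\<dots> = card K * (\<Sum>k\<in>K. (cmod (t k))\<^sup>2) * r\<^sup>2"
    by (simp add: r sum_distrib_right)
  finally have "l2_norm S (\<lambda>x. \<Sum>k\<in>K. t k * F k x) \<le> sqrt (card K * (\<Sum>k\<in>K. (cmod (t k))\<^sup>2) * r\<^sup>2)"
    by (simp add: l2_norm_def)
  also have "\<dots> = sqrt (card K * (\<Sum>k\<in>K. (cmod (t k))\<^sup>2)) * \<bar>r\<bar>"
    by (simp add: real_sqrt_mult)
  also have "\<dots> = sqrt (card K * (\<Sum>k\<in>K. (cmod (t k))\<^sup>2)) * r"
  proof (cases "K = {}")
    case False
    then obtain k where "k \<in> K" by auto
    then have "r \<ge> 0" using assms(3)[of k]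
      by (metis infsum_nonneg l2_norm_def real_sqrt_ge_zero zero_le_power2)
    then show ?thesis by simp
  qed auto
  finally show "l2_norm S (\<lambda>x. \<Sum>k\<in>K. t k * F k x) \<le> sqrt (card K * (\<Sum>k\<in>K. (cmod (t k))\<^sup>2)) * r" .
qed

lemma l2_lincomb2:
  assumes "f \<in> l2 S" "h \<in> l2 S"
  shows "(\<lambda>x. a * f x + b * h x) \<in> l2 S"
proof -
  let ?B = "\<lambda>x. 2 * ((cmod a)\<^sup>2 * (cmod (f x))\<^sup>2) + 2 * ((cmod b)\<^sup>2 * (cmod (h x))\<^sup>2)"
  have bd: "(cmod (a * f x + b * h x))\<^sup>2 \<le> ?B x" for x
  proof -
    have "(cmod (a * f x + b * h x))\<^sup>2 \<le> (cmod (a * f x) + cmod (b * h x))\<^sup>2"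
      by (intro power_mono norm_triangle_ineq) auto
    also have "\<dots> \<le> 2 * (cmod (a * f x))\<^sup>2 + 2 * (cmod (b * h x))\<^sup>2"
      using zero_le_power2[of "cmod (a * f x) - cmod (b * h x)"]
      unfolding power2_sum power2_diff by linarith
    finally show ?thesis by (simp add: norm_mult power_mult_distrib)
  qed
  have "?B summable_on S"
    by (intro summable_on_add summable_on_cmult_right) (use assms in \<open>auto simp: l2_def\<close>)
  then have "(\<lambda>x. (cmod (a * f x + b * h x))\<^sup>2) summable_on S"
    by (rule summable_on_comparison_test) (use bd in auto)
  then show ?thesis using assms by (auto simp: l2_def)
qed

lemma group_algebra_subset_bounded_ops:
  assumes "group \<Gamma>"
  shows "group_algebra \<Gamma> \<subseteq> bounded_ops (carrier \<Gamma>)"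
proof
  fix T assume "T \<in> group_algebra \<Gamma>"
  then obtain K t where K: "finite K" "K \<subseteq> carrier \<Gamma>" and T: "T = group_alg_elem \<Gamma> K t"
    by (auto simp: group_algebra_def)
  let ?S = "carrier \<Gamma>"
  have Tf: "T f = (\<lambda>x. \<Sum>g\<in>K. t g * left_reg \<Gamma> g f x)" if "f \<in> l2 ?S" for f
    using that by (simp add: T group_alg_elem_def)
  have in_l2: "left_reg \<Gamma> g f \<in> l2 ?S" "l2_norm ?S (left_reg \<Gamma> g f) = l2_norm ?S f"
    if "g \<in> K" "f \<in> l2 ?S" for g f
    using left_reg_l2[OF assms _ that(2), of g] that K by auto
  have "T f \<in> l2 ?S" if "f \<in> l2 ?S" for f
    unfolding Tf[OF that] by (rule l2_lincomb(1)[OF K(1)]) (use in_l2 that in auto)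
  moreover have "l2_norm ?S (T f) \<le> sqrt (card K * (\<Sum>k\<in>K. (cmod (t k))\<^sup>2)) * l2_norm ?S f"
    if "f \<in> l2 ?S" for f
    unfolding Tf[OF that] by (rule l2_lincomb(2)[OF K(1)]) (use in_l2 that in auto)
  moreover have "T (\<lambda>x. a * f x + b * h x) = (\<lambda>x. a * T f x + b * T h x)"
    if "f \<in> l2 ?S" "h \<in> l2 ?S" for f h a b
  proof -
    have "left_reg \<Gamma> g (\<lambda>x. a * f x + b * h x) = (\<lambda>x. a * left_reg \<Gamma> g f x + b * left_reg \<Gamma> g h x)" for g
      using that l2_lincomb2[OF that] by (auto simp: left_reg_def)
    then show ?thesis
      by (simp add: Tf that l2_lincomb2 sum.distrib sum_distrib_left algebra_simps)
  qed
  moreover have "T \<in> extensional (l2 ?S)" by (simp add: T group_alg_elem_def)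
  ultimately show "T \<in> bounded_ops ?S"
    unfolding bounded_ops_def PiE_def by blast
qed

lemma topspace_weak_operator_topology: "topspace (weak_operator_topology S) = bounded_ops S"
  by (auto simp: weak_operator_topology_def topspace_pullback_topology PiE_def)

lemma group_algebra_subset_group_vna:
  assumes "group \<Gamma>"
  shows "group_algebra \<Gamma> \<subseteq> carrier (group_vna \<Gamma>)"
  using closure_of_subset[of "group_algebra \<Gamma>" "weak_operator_topology (carrier \<Gamma>)"]
    group_algebra_subset_bounded_ops[OF assms]
  by (simp add: group_vna_def topspace_weak_operator_topology)

definition generating_op :: "nat \<Rightarrow> (letter list \<Rightarrow> complex) \<Rightarrow> (letter list \<Rightarrow> complex)" where
  "generating_op N =
     (\<lambda>f\<in>l2 (carrier (free_group N)). \<lambda>x.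
        (\<Sum>i=1..N. left_reg (free_group N) (gen i) f x)
      + (\<Sum>i=1..N. left_reg (free_group N) (inv\<^bsub>free_group N\<^esub> (gen i)) f x))"

lemma generating_op_in_group_vna: "generating_op N \<in> carrier (group_vna (free_group N))"
proof -
  let ?A = "gen ` {1..N}" and ?B = "(\<lambda>i. inv\<^bsub>free_group N\<^esub> (gen i)) ` {1..N}"
  have B: "?B = (\<lambda>i. [(i, False)]) ` {1..N}"
    by (rule image_cong) (auto simp: inv_gen)
  have inj: "inj_on gen {1..N}" "inj_on (\<lambda>i. inv\<^bsub>free_group N\<^esub> (gen i)) {1..N}"
    by (auto simp: inj_on_def inv_gen) (simp add: gen_def)
  have disj: "?A \<inter> ?B = {}" unfolding B by (auto simp: gen_def)
  have sub: "?A \<union> ?B \<subseteq> carrier (free_group N)"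
    using gen_in_carrier group.inv_closed[OF group_free_group] by blast
  have "generating_op N = group_alg_elem (free_group N) (?A \<union> ?B) (\<lambda>_. 1)"
    unfolding generating_op_def group_alg_elem_def
    by (rule restrict_ext, subst sum.union_disjoint[OF _ _ disj])
      (simp_all only: finite_imageI finite_atLeastAtMost sum.reindex[OF inj(1)] sum.reindex[OF inj(2)]
        o_def mult_1)
  then have "generating_op N \<in> group_algebra (free_group N)"
    using sub unfolding group_algebra_def by blast
  then show ?thesis using group_algebra_subset_group_vna[OF group_free_group] by blast
qed

text \<open>\<open>p_num N n k\<close> is $p^n_k$ for even $n$ and \<open>q_num N n k\<close> is $q^n_k$ for odd $n$.  Both are
  0 outside of the range of indices for which they are meant to be defined.\<close>

function p_num :: "nat \<Rightarrow> nat \<Rightarrow> nat \<Rightarrow> int" and q_num :: "nat \<Rightarrow> nat \<Rightarrow> nat \<Rightarrow> int" where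
  "p_num N n k =
     (if odd n \<or> odd k \<or> n < k + 2 then 0
      else if n = 2 then 2 * int N
      else if k = n - 2 then (2 * int N - 1) + q_num N (n - 1) (k - 1)
      else if k = 0 then 2 * int N * q_num N (n - 1) 1
      else (2 * int N - 1) * q_num N (n - 1) (k + 1) + q_num N (n - 1) (k - 1))"
| "q_num N n k =
     (if even n \<or> even k \<or> n < k + 2 then 0
      else if n = 3 then (2 * int N - 1) + 2 * int N
      else if k = n - 2 then (2 * int N - 1) + p_num N (n - 1) (k - 1)
      else (2 * int N - 1) * p_num N (n - 1) (k + 1) + p_num N (n - 1) (k - 1))"
  by pat_completeness auto
termination
  by (relation "Wellfounded.measure (case_sum (\<lambda>(_, n, _). n) (\<lambda>(_, n, _). n))") (auto intro: odd_pos)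

declare p_num.simps [simp del] q_num.simps [simp del]

lemma p_q_num_initial:
  "p_num N 2 0 = 2 * int N"
  "q_num N 3 1 = (2 * int N - 1) + 2 * int N"
  by (simp_all add: p_num.simps q_num.simps)

lemma p_q_num_recursion:
  assumes "m \<ge> 2"
  shows "p_num N (2*m) (2*m-2) = (2 * int N - 1) + q_num N (2*m-1) (2*m-3)"
    and "\<And>i. 1 \<le> i \<Longrightarrow> i \<le> m - 2 \<Longrightarrow> p_num N (2*m) (2*i) =
           (2 * int N - 1) * q_num N (2*m-1) (2*i+1) + q_num N (2*m-1) (2*i-1)"
    and "p_num N (2*m) 0 = 2 * int N * q_num N (2*m-1) 1"
    and "q_num N (2*m+1) (2*m-1) = (2 * int N - 1) + p_num N (2*m) (2*m-2)"
    and "\<And>i. i \<le> m - 2 \<Longrightarrow> q_num N (2*m+1) (2*i+1) =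
           (2 * int N - 1) * p_num N (2*m) (2*i+2) + p_num N (2*m) (2*i)"
proof -
  show "p_num N (2*m) (2*m-2) = (2 * int N - 1) + q_num N (2*m-1) (2*m-3)"
    using assms by (subst p_num.simps) (auto simp: numeral_3_eq_3)
  show "p_num N (2*m) 0 = 2 * int N * q_num N (2*m-1) 1"
    using assms by (subst p_num.simps) auto
  show "q_num N (2*m+1) (2*m-1) = (2 * int N - 1) + p_num N (2*m) (2*m-2)"
  proof -
    have "odd (2*m+1)" "odd (2*m-1)" "2*m+1 \<ge> 2*m-1+2" "2*m+1 \<noteq> 3"
      "2*m-1 = 2*m+1-2" "2*m+1-1 = 2*m" "2*m-1-1 = 2*m-2"
      using assms by auto
    then show ?thesis by (subst q_num.simps) simp
  qed
  fix i
  show "1 \<le> i \<Longrightarrow> i \<le> m - 2 \<Longrightarrow> p_num N (2*m) (2*i) =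
           (2 * int N - 1) * q_num N (2*m-1) (2*i+1) + q_num N (2*m-1) (2*i-1)"
    using assms by (subst p_num.simps) auto
  show "i \<le> m - 2 \<Longrightarrow> q_num N (2*m+1) (2*i+1) =
           (2 * int N - 1) * p_num N (2*m) (2*i+2) + p_num N (2*m) (2*i)"
    using assms by (subst q_num.simps) auto
qed

end

theory Submission
  imports Defs
begin

text \<open>The trace of $G^n$ is the value at the identity of $G^n \delta_e$.  Applied to a function,
  $G$ sums it over the $2N$ words obtained by multiplying a given word by one letter.  A
  nonempty reduced word becomes shorter under exactly one of these multiplications and longer
  under the other $2N - 1$; the empty word becomes longer under all $2N$.  So $G$ preserves
  functions that depend only on the word length, and if $c^n_k$ denotes the value of
  $G^n \delta_e$ on the words of length $k$, then
  \[ c^{n+1}_0 = 2N\, c^n_1, \qquad c^{n+1}_k = c^n_{k-1} + (2N-1)\, c^n_{k+1} \quad (k \ge 1),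
     \qquad c^0_k = [k = 0]. \]

  The lemmas \<open>sum_length_push\<close> and \<open>generating_op_iterate\<close> carry this part.

  This is also the recursion of the numbers $p$ and $q$, which are the entries $c^n_k$ with
  $k \le n - 2$ and $n$, $k$ of equal parity (\<open>p_q_num_eq_radial_coeff\<close>).  The remaining entries
  are trivial: $c^n_k = 0$ if $k > n$ or if $n$ and $k$ have different parity, and $c^n_n = 1$.
  The latter is why $p$ and $q$ have a separate rule for $k = n - 2 > 0$: its summand $2N - 1$ is
  $(2N-1)\, c^{n-1}_{n-1}$.  The vanishing for different parity gives trace 0 for odd $n$.\<close>

text \<open>The value of $G^n \delta_e$ on reduced words of length \<open>k\<close>, equivalently the number of
  ways to write a fixed reduced word of length \<open>k\<close> as a product of \<open>n\<close> letters.\<close>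

fun radial_coeff :: "nat \<Rightarrow> nat \<Rightarrow> nat \<Rightarrow> int" where
  "radial_coeff N 0 k = (if k = 0 then 1 else 0)"
| "radial_coeff N (Suc n) k =
     (if k = 0 then 2 * int N * radial_coeff N n 1
      else radial_coeff N n (k - 1) + (2 * int N - 1) * radial_coeff N n (k + 1))"

lemma radial_coeff_above: "n < k \<Longrightarrow> radial_coeff N n k = 0"
  by (induction n arbitrary: k) auto

lemma radial_coeff_diag: "radial_coeff N n n = 1"
  by (induction n) (auto simp: radial_coeff_above)

lemma radial_coeff_parity: "odd (n + k) \<Longrightarrow> radial_coeff N n k = 0"
proof (induction n arbitrary: k)
  case (Suc n)
  then show ?case by (cases k) auto
qed (auto intro: odd_pos)

lemma radial_coeff_zero_step:
  "n > 0 \<Longrightarrow> radial_coeff N n 0 = 2 * int N * radial_coeff N (n - 1) 1"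
  by (cases n) auto

lemma radial_coeff_pos_step:
  "n > 0 \<Longrightarrow> k > 0 \<Longrightarrow> radial_coeff N n k =
     radial_coeff N (n - 1) (k - 1) + (2 * int N - 1) * radial_coeff N (n - 1) (k + 1)"
  by (cases n) auto

lemma p_q_num_eq_radial_coeff:
  shows "even n \<Longrightarrow> even k \<Longrightarrow> k + 2 \<le> n \<Longrightarrow> p_num N n k = radial_coeff N n k"
    and "odd n \<Longrightarrow> odd k \<Longrightarrow> k + 2 \<le> n \<Longrightarrow> q_num N n k = radial_coeff N n k"
proof (induction n arbitrary: k rule: less_induct)
  case (less n)
  {
    case 1
    show ?case
    proof (cases "n = 2")
      case True
      then show ?thesis using 1
        by (subst p_num.simps) (auto simp: radial_coeff_zero_step radial_coeff_diag[of N 1, simplified])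
    next
      case n: False
      show ?thesis
      proof (cases "k = n - 2")
        case True
        \<comment> \<open>The entry on the diagonal is not among the numbers \<open>q\<close>; its value 1 gives the summand.\<close>
        have "radial_coeff N (n - 1) (k + 1) = 1"
          using True 1 radial_coeff_diag[of N "n - 1"] by (simp add: Suc_diff_Suc numeral_2_eq_2)
        moreover have "k > 0" "odd (k - 1)" "odd (n - 1)" "k - 1 + 2 \<le> n - 1"
          using True 1 n by (auto elim!: evenE)
        ultimately show ?thesis
          using 1 True n less(2)[of "n - 1" "k - 1"]
          by (subst p_num.simps) (simp add: radial_coeff_pos_step)
      next
        case False
        have n4: "k + 4 \<le> n" using 1 False by presburger
        have q: "q_num N (n - 1) (k + 1) = radial_coeff N (n - 1) (k + 1)"
          using 1 n4 by (intro less(2)) auto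
        show ?thesis
        proof (cases "k = 0")
          case True
          have "p_num N n k = 2 * int N * q_num N (n - 1) 1"
            using 1 True n4 by (subst p_num.simps) auto
          also have "\<dots> = radial_coeff N n k"
            using True n4 q radial_coeff_zero_step[of n N] by simp
          finally show ?thesis .
        next
          case k: False
          have "p_num N n k = (2 * int N - 1) * q_num N (n - 1) (k + 1) + q_num N (n - 1) (k - 1)"
            using 1 k n4 by (subst p_num.simps) auto
          also have "q_num N (n - 1) (k - 1) = radial_coeff N (n - 1) (k - 1)"
            using 1 k n4 by (intro less(2)) auto
          finally show ?thesis
            unfolding q using k n4 radial_coeff_pos_step[of n k N] by simp
        qed
      qed
    qed
  next
    case 2
    have k: "k > 0" "even (k - 1)" "even (k + 1)" "even (n - 1)" "k - 1 + 2 \<le> n - 1"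
      using 2 by (auto elim: oddE)
    have p: "p_num N (n - 1) (k - 1) = radial_coeff N (n - 1) (k - 1)"
      using less(1)[of "n - 1" "k - 1"] k 2 by simp
    show ?case
    proof (cases "k = n - 2")
      case True
      have "radial_coeff N (n - 1) (k + 1) = 1"
        using True 2 radial_coeff_diag[of N "n - 1"] by (simp add: Suc_diff_Suc numeral_2_eq_2)
      moreover have "p_num N 2 0 = 2 * int N" by (simp add: p_q_num_initial)
      ultimately show ?thesis
        using 2 True k p
        by (subst q_num.simps) (auto simp: radial_coeff_pos_step)
    next
      case False
      have n4: "k + 4 \<le> n" using 2 False by presburger
      have "q_num N n k = (2 * int N - 1) * p_num N (n - 1) (k + 1) + p_num N (n - 1) (k - 1)"
        using 2 k n4 by (subst q_num.simps) auto
      also have "p_num N (n - 1) (k + 1) = radial_coeff N (n - 1) (k + 1)"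
        using 2 n4 by (intro less(1)) auto
      finally show ?thesis
        unfolding p using k n4 radial_coeff_pos_step[of n k N] by simp
    qed
  }
qed

text \<open>Of the letters, only the inverse of the first letter of a nonempty word cancels in it.\<close>

lemma sum_length_push:
  fixes h :: "nat \<Rightarrow> 'b::comm_ring_1"
  assumes "set w \<subseteq> {1..N} \<times> UNIV"
  shows "(\<Sum>a\<in>{1..N} \<times> UNIV. h (length (push a w))) =
           (if w = [] then of_nat (2 * N) * h 1
            else h (length w - 1) + of_int (2 * int N - 1) * h (length w + 1))"
proof (cases w)
  case Nil
  then show ?thesis by (simp add: card_cartesian_product mult.commute)
next
  case (Cons b v)
  let ?L = "{1..N} \<times> (UNIV :: bool set)"
  have b: "inv_letter b \<in> ?L" using assms Cons by simp
  have N: "N \<ge> 1" using b by (auto simp: mem_Times_iff)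
  have fin: "finite ?L" by simp
  have "(\<Sum>a\<in>?L. h (length (push a w))) =
        h (length (push (inv_letter b) w)) + (\<Sum>a\<in>?L - {inv_letter b}. h (length (push a w)))"
    by (rule sum.remove[OF fin b])
  also have "(\<Sum>a\<in>?L - {inv_letter b}. h (length (push a w))) = (\<Sum>a\<in>?L - {inv_letter b}. h (length w + 1))"
    by (rule sum.cong) (use Cons in auto)
  also have "\<dots> = of_nat (card (?L - {inv_letter b})) * h (length w + 1)"
    by simp
  also have "card (?L - {inv_letter b}) = 2 * N - 1"
    using b fin by (simp add: card_Diff_singleton card_cartesian_product mult.commute)
  also have "(of_nat (2 * N - 1) :: 'b) = of_int (2 * int N - 1)"
    using N by (simp add: of_nat_diff)
  finally show ?thesis using Cons by simp
qed

text \<open>The translation by $g$ evaluates at $g^{-1} x$, and the inverses of the summands of $G$ are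
  again all the letters.\<close>

lemma generating_op_apply:
  assumes "f \<in> l2 (carrier (free_group N))"
  shows "generating_op N f x =
           (if x \<in> carrier (free_group N) then \<Sum>a\<in>{1..N} \<times> UNIV. f (push a x) else 0)"
proof (cases "x \<in> carrier (free_group N)")
  case True
  interpret group "free_group N" by (rule group_free_group)
  have left: "left_reg (free_group N) (gen i) f x = f (push (i, False) x)"
    if "i \<in> {1..N}" for i
    using assms True inv_gen[OF that] by (simp add: left_reg_def) (simp add: free_group_def)
  have right: "left_reg (free_group N) (inv\<^bsub>free_group N\<^esub> (gen i)) f x = f (push (i, True) x)"
    if "i \<in> {1..N}" for i
    using assms True gen_in_carrier[OF that]
    by (simp add: left_reg_def) (simp add: free_group_def gen_def)
  have "generating_op N f x = (\<Sum>i=1..N. f (push (i, False) x)) + (\<Sum>i=1..N. f (push (i, True) x))"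
    using assms left right by (simp add: generating_op_def)
  also have "\<dots> = (\<Sum>i=1..N. \<Sum>b\<in>UNIV. f (push (i, b) x))"
    by (simp add: UNIV_bool sum.distrib)
  also have "\<dots> = (\<Sum>a\<in>{1..N} \<times> UNIV. f (push a x))"
    by (simp add: sum.cartesian_product)
  finally show ?thesis using True by simp
next
  case False
  then show ?thesis using assms by (simp add: generating_op_def left_reg_def)
qed

lemma generating_op_l2:
  assumes "f \<in> l2 (carrier (free_group N))"
  shows "generating_op N f \<in> l2 (carrier (free_group N))"
proof -
  have "generating_op N \<in> bounded_ops (carrier (free_group N))"
    using generating_op_in_group_vna[of N]
      closure_of_subset_topspace[of "weak_operator_topology (carrier (free_group N))"]
    unfolding group_vna_def topspace_weak_operator_topology by auto
  then show ?thesis using assms by (auto simp: bounded_ops_def)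
qed

lemma group_vna_power_apply:
  assumes "\<And>f. f \<in> l2 (carrier \<Gamma>) \<Longrightarrow> T f \<in> l2 (carrier \<Gamma>)" "f \<in> l2 (carrier \<Gamma>)"
  shows "(T [^]\<^bsub>group_vna \<Gamma>\<^esub> n) f = (T ^^ n) f"
  using assms(2)
proof (induction n arbitrary: f)
  case 0
  then show ?case by (simp add: nat_pow_def group_vna_def)
next
  case (Suc n)
  \<comment> \<open>The power of the ring puts the new factor on the right, so \<open>T\<close> acts first.\<close>
  have "(T [^]\<^bsub>group_vna \<Gamma>\<^esub> Suc n) f = (T [^]\<^bsub>group_vna \<Gamma>\<^esub> n) (T f)"
    using Suc.prems by (simp add: nat_pow_def group_vna_def compose_def)
  then show ?case using Suc.IH[OF assms(1)[OF Suc.prems]] by (simp add: funpow_swap1)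
qed

lemma push_in_carrier:
  assumes "a \<in> {1..N} \<times> UNIV" "x \<in> carrier (free_group N)"
  shows "push a x \<in> carrier (free_group N)"
  using assms set_push[of a x] reduced_push[of x a] by (auto simp: free_group_def)

text \<open>The iterates must be known to be square summable along with their values, because the
  generating operator acts by its formula only on such functions.\<close>

lemma generating_op_iterate:
  fixes N n :: nat
  defines "G \<equiv> generating_op N ^^ n"
  shows "G (delta []) \<in> l2 (carrier (free_group N))"
    and "x \<in> carrier (free_group N) \<Longrightarrow> G (delta []) x = of_int (radial_coeff N n (length x))"
  unfolding G_def
proof (induction n arbitrary: x)
  case 0
  {
    case 1
    show ?case by (simp add: delta_in_l2 free_group_def)
  next
    case 2
    show ?case by (simp add: delta_def)
  }
next
  case (Suc n)
  {
    case 1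
    show ?case using generating_op_l2[OF Suc(1)] by simp
  next
    case 2
    have "set x \<subseteq> {1..N} \<times> UNIV" using 2 by (simp add: free_group_def)
    note step = sum_length_push[OF this, of "\<lambda>k. of_int (radial_coeff N n k) :: complex"]
    have "(generating_op N ^^ Suc n) (delta []) x =
          (\<Sum>a\<in>{1..N} \<times> UNIV. (generating_op N ^^ n) (delta []) (push a x))"
      using generating_op_apply[OF Suc(1)] 2 by simp
    also have "\<dots> = (\<Sum>a\<in>{1..N} \<times> UNIV. of_int (radial_coeff N n (length (push a x))))"
      by (rule sum.cong) (use Suc(2) push_in_carrier 2 in auto)
    also have "\<dots> = of_int (radial_coeff N (Suc n) (length x))"
      unfolding step by simp
    finally show ?case .
  }
qed

theorem theorem1p2:
  fixes N n :: nat
  assumes "N \<ge> 1" and "n \<ge> 1"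
  shows "vna_trace (free_group N) (generating_op N [^]\<^bsub>group_vna (free_group N)\<^esub> n) =
           (if odd n then 0 else of_int (p_num N n 0))"
proof -
  let ?\<Gamma> = "free_group N"
  have one: "\<one>\<^bsub>?\<Gamma>\<^esub> = []" and e: "[] \<in> carrier ?\<Gamma>" by (simp_all add: free_group_def)
  have "vna_trace ?\<Gamma> (generating_op N [^]\<^bsub>group_vna ?\<Gamma>\<^esub> n) = (generating_op N ^^ n) (delta []) []"
    unfolding vna_trace_def vna_coeff_def one
    by (subst group_vna_power_apply) (auto intro: generating_op_l2 delta_in_l2 e)
  also have "\<dots> = of_int (radial_coeff N n 0)"
    using generating_op_iterate(2)[OF e] by simp
  also have "\<dots> = (if odd n then 0 else of_int (p_num N n 0))"
  proof (cases "odd n")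
    case True
    then show ?thesis by (simp add: radial_coeff_parity)
  next
    case False
    then have "0 + 2 \<le> n" using assms(2) by (auto elim!: evenE)
    then show ?thesis using False p_q_num_eq_radial_coeff(1)[of n 0 N] by simp
  qed
  finally show ?thesis .
qed

end
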